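(* Let $0\le\alpha\le 1$ and let $f\in\mathcal{BS}(\alpha)$. Then the logarithmic coefficients $\gamma_n$ of $f$ satisfy $$|\gamma_n|\leq\frac{1}{2n}\qquad (n\geq1).$$
   Context: $\Delta=\{z\in\mathbb{C}:|z|<1\}$ is the open unit disk. $\mathcal{A}$ is the class of analytic functions $f$ on $\Delta$ of the form $f(z)=z+a_2z^2+a_3z^3+\cdots$. $\mathfrak{B}$ is the class of analytic functions $w$ on $\Delta$ with $w(0)=0$ and $|w(z)|<1$ for $z\in\Delta$. For analytic $f,g$ on $\Delta$, $f\prec g$ ($f$ is subordinate to $g$) means that there is $w\in\mathfrak{B}$ with $f(z)=g(w(z))$ for all $z\in\Delta$. For $0\le\alpha\le1$, $F_\alpha(z)=\frac{z}{1-\alpha z^2}=\sum_{n=1}^\infty \alpha^{n-1}z^{2n-1}$ for $z\in\Delta$. $\mathcal{BS}(\alpha)$ is the class of all $f\in\mathcal{A}$ such that $\frac{zf'(z)}{f(z)}-1\prec F_\alpha(z)$ in $\Delta$. The logarithmic coefficients $\gamma_n$ of $f$ are defined by $\log\frac{f(z)}{z}=\sum_{n=1}^\infty 2\gamma_n z^n$ for $z\in\Delta$ (the branch of the logarithm vanishing at $z=0$). *)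

theory Defs
  imports "HOL-Complex_Analysis.Complex_Analysis"
begin

abbreviation unit_disk :: "complex set"  (\<open>\<Delta>\<close>) where
  "\<Delta> \<equiv> ball 0 1"

definition class_A :: "(complex \<Rightarrow> complex) set" where
  "class_A = {f. f holomorphic_on \<Delta> \<and> f 0 = 0 \<and> deriv f 0 = 1}"

definition class_B :: "(complex \<Rightarrow> complex) set" where
  "class_B = {w. w holomorphic_on \<Delta> \<and> w 0 = 0 \<and> (\<forall>z\<in>\<Delta>. norm (w z) < 1)}"

definition subordinate :: "(complex \<Rightarrow> complex) \<Rightarrow> (complex \<Rightarrow> complex) \<Rightarrow> bool"  (infix \<open>\<prec>\<close> 50) where
  "f \<prec> g \<longleftrightarrow> f holomorphic_on \<Delta> \<and> g holomorphic_on \<Delta> \<and>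
     (\<exists>w\<in>class_B. \<forall>z\<in>\<Delta>. f z = g (w z))"

definition booth :: "real \<Rightarrow> complex \<Rightarrow> complex" where
  "booth \<alpha> z = z / (1 - of_real \<alpha> * z\<^sup>2)"

(* For f in class_A the quotient z f'(z) / f(z) has a removable singularity at 0 with value 1;
   the case distinction replaces the value 0 / 0 = 0 of HOL.  At any other zero of f the quotient
   has a pole, so that holomorphy of the quotient on the disk excludes such zeros. *)
definition log_deriv_quotient :: "(complex \<Rightarrow> complex) \<Rightarrow> complex \<Rightarrow> complex" where
  "log_deriv_quotient f z = (if z = 0 then 1 else z * deriv f z / f z)"

definition class_BS :: "real \<Rightarrow> (complex \<Rightarrow> complex) set" where
  "class_BS \<alpha> = {f \<in> class_A. (\<lambda>z. log_deriv_quotient f z - 1) \<prec> booth \<alpha>}"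

(* L is the branch of log (f(z) / z) on the disk that vanishes at 0. *)
definition is_log_branch :: "(complex \<Rightarrow> complex) \<Rightarrow> (complex \<Rightarrow> complex) \<Rightarrow> bool" where
  "is_log_branch f L \<longleftrightarrow> L holomorphic_on \<Delta> \<and> L 0 = 0 \<and> (\<forall>z\<in>\<Delta> - {0}. exp (L z) = f z / z)"

definition is_log_coeffs :: "(complex \<Rightarrow> complex) \<Rightarrow> (nat \<Rightarrow> complex) \<Rightarrow> bool" where
  "is_log_coeffs f \<gamma> \<longleftrightarrow> (\<exists>L. is_log_branch f L \<and>
     (\<forall>z\<in>\<Delta>. (\<lambda>n. 2 * \<gamma> (Suc n) * z ^ Suc n) sums L z))"

(* The coefficients are indexed from 1; the unused index 0 is normalised to 0 to make
   the sequence unique. *)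
definition log_coeff :: "(complex \<Rightarrow> complex) \<Rightarrow> nat \<Rightarrow> complex" where
  "log_coeff f = (THE \<gamma>. \<gamma> 0 = 0 \<and> is_log_coeffs f \<gamma>)"

lemma class_BS_nonzero:
  assumes f: "f \<in> class_BS \<alpha>" and z: "z \<in> \<Delta> - {0}"
  shows "f z \<noteq> 0"
proof
  assume fz: "f z = 0"
  define h where "h = log_deriv_quotient f"
  have holf: "f holomorphic_on \<Delta>" and f0: "f 0 = 0" and f1: "deriv f 0 = 1"
    using f by (auto simp: class_BS_def class_A_def)
  have "(\<lambda>z. h z - 1) holomorphic_on \<Delta>"
    using f by (auto simp: class_BS_def subordinate_def h_def)
  then have "(\<lambda>z. (h z - 1) + 1) holomorphic_on \<Delta>"
    by (intro holomorphic_on_add holomorphic_on_const)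
  then have holh: "h holomorphic_on \<Delta>" by simp
  have nc: "\<not> f constant_on \<Delta>"
  proof
    assume "f constant_on \<Delta>"
    then obtain c where c: "\<And>x. x \<in> \<Delta> \<Longrightarrow> f x = c"
      by (auto simp: constant_on_def)
    have "deriv f 0 = deriv (\<lambda>_. c) 0"
      by (rule complex_derivative_transform_within_open[OF holf holomorphic_on_const open_ball])
         (simp_all add: c)
    then show False using f1 by simp
  qed
  obtain g r n where n: "0 < n" and r: "0 < r" "ball z r \<subseteq> \<Delta>"
    and holg: "g holomorphic_on ball z r"
    and fg: "\<And>w. w \<in> ball z r \<Longrightarrow> f w = (w - z) ^ n * g w"
    and g0: "\<And>w. w \<in> ball z r \<Longrightarrow> g w \<noteq> 0"
    by (rule holomorphic_factor_zero_nonconstant[OF holf open_ball connected_ball _ fz nc])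
       (use z in blast)+
  have eq: "h w * (w - z) * g w = w * (of_nat n * g w + (w - z) * deriv g w)"
    if w: "w \<in> ball z r - {z, 0}" for w
  proof -
    have dg: "(g has_field_derivative deriv g w) (at w)"
      using holg w by (auto intro: holomorphic_derivI)
    have "((\<lambda>w. (w - z) ^ n * g w) has_field_derivative
            of_nat n * (w - z) ^ (n - 1) * g w + (w - z) ^ n * deriv g w) (at w)"
      by (auto intro!: derivative_eq_intros dg)
    then have "(f has_field_derivative
            of_nat n * (w - z) ^ (n - 1) * g w + (w - z) ^ n * deriv g w) (at w)"
      by (rule has_field_derivative_transform_within_open[of _ _ _ "ball z r"])
         (use w fg in auto)
    then have "deriv f w = of_nat n * (w - z) ^ (n - 1) * g w + (w - z) ^ n * deriv g w"
      by (rule DERIV_imp_deriv)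
    also have "\<dots> = (w - z) ^ (n - 1) * (of_nat n * g w + (w - z) * deriv g w)"
      using n by (cases n) (auto simp: algebra_simps)
    finally have d: "deriv f w = (w - z) ^ (n - 1) * (of_nat n * g w + (w - z) * deriv g w)" .
    have fw: "f w = (w - z) ^ (n - 1) * ((w - z) * g w)"
      using fg[of w] w n by (cases n) auto
    have nz: "(w - z) ^ (n - 1) \<noteq> 0" "(w - z) * g w \<noteq> 0" using w g0 by auto
    have "h w = w * (of_nat n * g w + (w - z) * deriv g w) / ((w - z) * g w)"
      unfolding h_def log_deriv_quotient_def d fw using w nz by simp
    then show ?thesis using nz by (simp add: field_simps)
  qed
  have ev: "\<forall>\<^sub>F w in at z. w \<in> ball z r - {z, 0}"
  proof -
    have "open (ball z r - {0})" "z \<in> ball z r - {0}" using r z by auto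
    then have "\<forall>\<^sub>F w in at z. w \<in> ball z r - {0} - {z}"
      by (rule eventually_at_in_open)
    then show ?thesis by eventually_elim auto
  qed
  have zD: "z \<in> \<Delta>" using z by simp
  have zr: "z \<in> ball z r" using r by simp
  have lim: "u \<midarrow>z\<rightarrow> u z" if "u holomorphic_on S" "open S" "z \<in> S" for u :: "complex \<Rightarrow> complex" and S
    using continuous_on_eq_continuous_at holomorphic_on_imp_continuous_on isContD that by blast
  note ch = lim[OF holh open_ball] lim[OF holg open_ball zr]
    lim[OF holomorphic_deriv[OF holg open_ball] open_ball zr]
  have "((\<lambda>w. h w * (w - z) * g w) \<longlongrightarrow> h z * (z - z) * g z) (at z)"
    by (intro tendsto_intros ch zD)
  then have "((\<lambda>w. w * (of_nat n * g w + (w - z) * deriv g w)) \<longlongrightarrow> h z * (z - z) * g z) (at z)"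
    by (rule Lim_transform_eventually) (rule eventually_mono[OF ev], rule eq)
  moreover have "((\<lambda>w. w * (of_nat n * g w + (w - z) * deriv g w)) \<longlongrightarrow>
      z * (of_nat n * g z + (z - z) * deriv g z)) (at z)"
    by (intro tendsto_intros ch zD)
  ultimately have "h z * (z - z) * g z = z * (of_nat n * g z + (z - z) * deriv g z)"
    by (rule LIM_unique)
  then show False using z n g0[OF zr] by simp
qed

lemma is_log_branch_unique:
  assumes L: "is_log_branch f L" and M: "is_log_branch f M" and z: "z \<in> \<Delta>"
  shows "L z = M z"
proof -
  have hol: "(\<lambda>z. L z - M z) holomorphic_on \<Delta>"
    using L M by (auto simp: is_log_branch_def intro!: holomorphic_intros)
  have der: "((\<lambda>z. L z - M z) has_field_derivative 0) (at u within \<Delta>)" if u: "u \<in> \<Delta>" for u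
  proof -
    have dif: "((\<lambda>z. L z - M z) has_field_derivative deriv (\<lambda>z. L z - M z) u) (at u)"
      if "u \<in> \<Delta>" for u using hol that by (auto intro: holomorphic_derivI)
    have one: "exp (L u - M u) = 1" if "u \<in> \<Delta>" for u
    proof -
      have "exp (L u) = exp (M u)"
        using L M that by (cases "u = 0") (simp_all add: is_log_branch_def)
      then show ?thesis by (simp add: exp_diff)
    qed
    have "((\<lambda>z. exp (L z - M z)) has_field_derivative
            exp (L u - M u) * deriv (\<lambda>z. L z - M z) u) (at u)"
      by (rule DERIV_chain2[OF DERIV_exp dif[OF u]])
    moreover have "((\<lambda>z. exp (L z - M z)) has_field_derivative 0) (at u)"
      by (rule has_field_derivative_transform_within_open[OF DERIV_const[of 1] open_ball u])
         (use one in auto)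
    ultimately have "exp (L u - M u) * deriv (\<lambda>z. L z - M z) u = 0"
      by (rule DERIV_unique)
    then show ?thesis using dif[OF u] by (auto intro: has_field_derivative_at_within)
  qed
  obtain c where "\<And>u. u \<in> \<Delta> \<Longrightarrow> L u - M u = c"
    using has_field_derivative_zero_constant[of \<Delta> "\<lambda>z. L z - M z"] der by auto
  from this[OF z] this[of 0] show ?thesis using L M by (auto simp: is_log_branch_def)
qed

lemma ex1_log_coeffs:
  assumes f: "f \<in> class_A" and nz: "\<And>z. z \<in> \<Delta> - {0} \<Longrightarrow> f z \<noteq> 0"
  shows "\<exists>!\<gamma>. \<gamma> 0 = 0 \<and> is_log_coeffs f \<gamma>"
proof (rule ex_ex1I)
  define q where "q = (\<lambda>z. if z = 0 then deriv f 0 else (f z - f 0) / (z - 0))"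
  have "q holomorphic_on \<Delta>"
    unfolding q_def using f by (intro pole_lemma_open) (auto simp: class_A_def)
  moreover have q0: "q 0 = 1" and qz: "\<And>z. z \<noteq> 0 \<Longrightarrow> q z = f z / z"
    using f by (auto simp: q_def class_A_def)
  moreover have "q z \<noteq> 0" if "z \<in> \<Delta>" for z
    using nz[of z] f that by (cases "z = 0") (auto simp: q_def class_A_def)
  ultimately obtain K where K: "K holomorphic_on \<Delta>" "\<And>z. z \<in> \<Delta> \<Longrightarrow> q z = exp (K z)"
    using contractible_imp_holomorphic_log[of q \<Delta>, OF _ convex_imp_contractible[OF convex_ball]]
    by blast
  define L where "L = (\<lambda>z. K z - K 0)"
  have "exp (K 0) = 1" using K(2)[of 0] q0 by simp
  then have L: "is_log_branch f L"
    unfolding is_log_branch_def L_def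
    using K(1) K(2)[symmetric] qz by (auto intro!: holomorphic_intros simp: exp_diff)
  define \<gamma> where "\<gamma> = (\<lambda>n. (deriv ^^ n) L 0 / fact n / 2)"
  have g0: "\<gamma> 0 = 0" by (simp add: \<gamma>_def L_def)
  have "(\<lambda>n. 2 * \<gamma> (Suc n) * z ^ Suc n) sums L z" if z: "z \<in> \<Delta>" for z
  proof -
    have "(\<lambda>n. (deriv ^^ n) L 0 / fact n * (z - 0) ^ n) sums L z"
      using L z by (intro holomorphic_power_series) (auto simp: is_log_branch_def)
    then have "(\<lambda>n. 2 * \<gamma> n * z ^ n) sums L z" by (simp add: \<gamma>_def)
    then show ?thesis
      by (intro iffD2[OF sums_Suc_iff[of "\<lambda>n. 2 * \<gamma> n * z ^ n"]]) (simp add: g0)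
  qed
  then have "is_log_coeffs f \<gamma>" using L by (auto simp: is_log_coeffs_def)
  then show "\<exists>\<gamma>. \<gamma> 0 = 0 \<and> is_log_coeffs f \<gamma>"
    by (intro exI[of _ \<gamma>]) (simp add: g0)
next
  fix \<gamma> \<gamma>'
  assume A: "\<gamma> 0 = 0 \<and> is_log_coeffs f \<gamma>" and B: "\<gamma>' 0 = 0 \<and> is_log_coeffs f \<gamma>'"
  obtain L where L: "is_log_branch f L"
    "\<And>z. z \<in> \<Delta> \<Longrightarrow> (\<lambda>n. 2 * \<gamma> (Suc n) * z ^ Suc n) sums L z"
    using conjunct2[OF A] unfolding is_log_coeffs_def by (elim exE conjE) (rule that, auto)
  obtain M where M: "is_log_branch f M"
    "\<And>z. z \<in> \<Delta> \<Longrightarrow> (\<lambda>n. 2 * \<gamma>' (Suc n) * z ^ Suc n) sums M z"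
    using conjunct2[OF B] unfolding is_log_coeffs_def by (elim exE conjE) (rule that, auto)
  have sL: "(\<lambda>n. 2 * \<gamma> n * z ^ n) sums L z" if "z \<in> \<Delta>" for z
    using A by (intro sums_Suc_imp[of "\<lambda>n. 2 * \<gamma> n * z ^ n"] L(2) that) simp
  have sM: "(\<lambda>n. 2 * \<gamma>' n * z ^ n) sums L z" if "z \<in> \<Delta>" for z
    unfolding is_log_branch_unique[OF L(1) M(1) that] using B
    by (intro sums_Suc_imp[of "\<lambda>n. 2 * \<gamma>' n * z ^ n"] M(2) that) simp
  have ev: "\<forall>\<^sub>F z in nhds 0. z \<in> \<Delta>"
    by (rule eventually_nhds_in_open) auto
  have "L has_fps_expansion Abs_fps (\<lambda>n. 2 * \<gamma> n)"
    by (rule has_fps_expansionI, rule eventually_mono[OF ev], unfold fps_nth_Abs_fps, rule sL)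
  moreover have "L has_fps_expansion Abs_fps (\<lambda>n. 2 * \<gamma>' n)"
    by (rule has_fps_expansionI, rule eventually_mono[OF ev], unfold fps_nth_Abs_fps, rule sM)
  ultimately have "Abs_fps (\<lambda>n. 2 * \<gamma> n) = Abs_fps (\<lambda>n. 2 * \<gamma>' n)"
    by (rule fps_expansion_unique_complex)
  then have "fps_nth (Abs_fps (\<lambda>n. 2 * \<gamma> n)) n = fps_nth (Abs_fps (\<lambda>n. 2 * \<gamma>' n)) n" for n
    by (rule arg_cong)
  then have "\<gamma> n = \<gamma>' n" for n by simp
  then show "\<gamma> = \<gamma>'" by (rule ext)
qed

lemma is_log_coeffs_log_coeff:
  assumes "f \<in> class_BS \<alpha>"
  shows "log_coeff f 0 = 0 \<and> is_log_coeffs f (log_coeff f)"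
proof -
  have "\<exists>!\<gamma>. \<gamma> 0 = 0 \<and> is_log_coeffs f \<gamma>"
    using assms class_BS_nonzero[OF assms] by (intro ex1_log_coeffs) (auto simp: class_BS_def)
  from theI'[OF this] show ?thesis by (simp add: log_coeff_def)
qed

end

theory Submission
  imports Defs
begin

text \<open>
  Write \<open>\<alpha> = \<beta>\<^sup>2\<close>. If \<open>L\<close> is the branch of the logarithm of \<open>f(z)/z\<close>, then
  \<open>z L'(z) = z f'(z)/f(z) - 1\<close>, and the coefficient of \<open>z^n\<close> on the left is \<open>2 n \<gamma>\<^sub>n\<close>. So the
  claim is that every coefficient of a function subordinate to \<open>F\<^sub>\<alpha>\<close> has modulus at most 1.
  For larger \<open>\<alpha>\<close> the function \<open>F\<^sub>\<alpha>\<close> is not convex, so the coefficient bound for functions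
  subordinate to a convex function does not apply to \<open>F\<^sub>\<alpha>\<close> itself. But \<open>F\<^sub>\<alpha>\<close> is the mean of
  two convex functions,
  \<open>F\<^sub>\<alpha>(w) = 1/2 (w / (1 - \<beta> w) + w / (1 + \<beta> w))\<close>, each of which maps the disk onto a disk or
  a half-plane. It is therefore enough to bound by 1 the coefficients of
  \<open>s = w / (1 - b w)\<close>, for a Schwarz function \<open>w\<close> and \<open>\<bar>b\<bar> \<le> 1\<close>.

  This bound is Rogosinski's argument. The values of \<open>s\<close> lie in the convex set
  \<open>{s. \<bar>s\<bar> < \<bar>1 + b s\<bar>}\<close>, hence so do those of the mean \<open>S\<close> of \<open>s\<close> over the rotations of its
  argument by the \<open>n\<close>-th roots of unity. The mean keeps the coefficient of \<open>z^n\<close> and removes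
  all lower ones, so \<open>S / (1 + b S)\<close> has that same coefficient of \<open>z^n\<close>. As this quotient is
  bounded by 1 on the disk, Cauchy's inequality finishes the proof.
\<close>

section \<open>Coefficients of bounded functions\<close>

text \<open>
  The function need not extend to the closed disk, so Cauchy's inequality is used on circles of
  radius \<open>r < 1\<close>, followed by \<open>r \<rightarrow> 1\<close>.
\<close>
lemma bounded_on_disk_coeff_le:
  fixes h :: "complex \<Rightarrow> complex"
  assumes hol: "h holomorphic_on \<Delta>" and bd: "\<And>z. z \<in> \<Delta> \<Longrightarrow> norm (h z) \<le> 1"
    and H: "h has_fps_expansion H"
  shows "norm (fps_nth H n) \<le> 1"
proof -
  have coeff: "fps_nth H n = (deriv ^^ n) h 0 / fact n"
    using fps_nth_fps_expansion[OF H] .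
  have r: "norm (fps_nth H n) * r ^ n \<le> 1" if "r \<in> {0<..<1}" for r :: real
  proof -
    have "cball (0::complex) r \<subseteq> \<Delta>" "ball (0::complex) r \<subseteq> \<Delta>" using that by auto
    then have "norm ((deriv ^^ n) h 0) \<le> fact n * 1 / r ^ n"
      using that hol bd
      by (intro Cauchy_inequality)
         (auto intro: holomorphic_on_subset holomorphic_on_imp_continuous_on)
    then show ?thesis
      using that by (simp add: coeff norm_divide field_simps)
  qed
  have "((\<lambda>r. norm (fps_nth H n) * r ^ n) \<longlongrightarrow> norm (fps_nth H n) * 1 ^ n) (at_left (1::real))"
    by (intro tendsto_intros)
  moreover have "\<forall>\<^sub>F r in at_left (1::real). norm (fps_nth H n) * r ^ n \<le> 1"
    using eventually_at_left_real[of 0 "1::real"] by (auto elim!: eventually_mono intro: r)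
  ultimately show ?thesis
    using tendsto_upperbound[of _ _ "at_left (1::real)" 1] by simp
qed

section \<open>The convex image of a linear fractional map\<close>

text \<open>
  The condition \<open>\<bar>s\<bar> < \<bar>1 + b s\<bar>\<close> says that \<open>s / (1 + b s)\<close> lies in the unit disk, so the set
  is the image of the disk under the inverse map \<open>w / (1 - b w)\<close>. Squaring turns the condition
  into \<open>(1 - \<bar>b\<bar>\<^sup>2) \<bar>s\<bar>\<^sup>2 - 2 Re (b s) < 1\<close>, a sublevel set of a convex function, because
  \<open>\<bar>b\<bar> \<le> 1\<close>.
\<close>
lemma convex_mobius_image:
  fixes b :: complex
  assumes b: "norm b \<le> 1"
  shows "convex {s. norm s < norm (1 + b * s)}"
proof -
  have iff: "norm s < norm (1 + b * s) \<longleftrightarrow> (1 - (norm b)\<^sup>2) * (norm s)\<^sup>2 - 2 * Re (b * s) < 1"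
    for s
  proof -
    have "norm s < norm (1 + b * s) \<longleftrightarrow> (norm s)\<^sup>2 < (norm (1 + b * s))\<^sup>2"
      by (simp add: power_mono_iff flip: not_le)
    also have "(norm (1 + b * s))\<^sup>2 = 1 + 2 * Re (b * s) + (norm b)\<^sup>2 * (norm s)\<^sup>2"
      by (simp add: cmod_power2) (simp add: power2_eq_square algebra_simps)
    finally show ?thesis by (simp add: algebra_simps)
  qed
  have c: "0 \<le> 1 - (norm b)\<^sup>2" using b by (simp add: power_le_one)
  have sq: "(norm (u *\<^sub>R s + v *\<^sub>R t))\<^sup>2 \<le> u * (norm s)\<^sup>2 + v * (norm t)\<^sup>2"
    if "0 \<le> u" "0 \<le> v" "u + v = 1" for u v :: real and s t :: complex
  proof -
    have v: "v = 1 - u" using that by simp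
    have "u * (norm s)\<^sup>2 + v * (norm t)\<^sup>2 - (norm (u *\<^sub>R s + v *\<^sub>R t))\<^sup>2
            = u * v * (norm (s - t))\<^sup>2"
      unfolding v by (simp add: cmod_power2) (simp add: power2_eq_square algebra_simps)
    moreover have "0 \<le> u * v * (norm (s - t))\<^sup>2" using that by simp
    ultimately show ?thesis by linarith
  qed
  show ?thesis
    unfolding convex_def mem_Collect_eq iff
  proof (intro ballI allI impI, unfold mem_Collect_eq)
    fix s t :: complex and u v :: real
    assume s: "(1 - (norm b)\<^sup>2) * (norm s)\<^sup>2 - 2 * Re (b * s) < 1"
      and t: "(1 - (norm b)\<^sup>2) * (norm t)\<^sup>2 - 2 * Re (b * t) < 1"
      and uv: "0 \<le> u" "0 \<le> v" "u + v = 1"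
    have "(1 - (norm b)\<^sup>2) * (norm (u *\<^sub>R s + v *\<^sub>R t))\<^sup>2 - 2 * Re (b * (u *\<^sub>R s + v *\<^sub>R t))
        \<le> (1 - (norm b)\<^sup>2) * (u * (norm s)\<^sup>2 + v * (norm t)\<^sup>2)
            - 2 * Re (b * (u *\<^sub>R s + v *\<^sub>R t))"
      using mult_left_mono[OF sq[OF uv] c] by simp
    also have "\<dots> = u * ((1 - (norm b)\<^sup>2) * (norm s)\<^sup>2 - 2 * Re (b * s))
                  + v * ((1 - (norm b)\<^sup>2) * (norm t)\<^sup>2 - 2 * Re (b * t))"
      by (simp add: algebra_simps)
    also have "\<dots> < 1" by (rule convex_bound_lt[OF s t uv])
    finally show "(1 - (norm b)\<^sup>2) * (norm (u *\<^sub>R s + v *\<^sub>R t))\<^sup>2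
        - 2 * Re (b * (u *\<^sub>R s + v *\<^sub>R t)) < 1" .
  qed
qed

lemma one_minus_mult_nonzero:
  fixes b w :: complex
  assumes "norm b \<le> 1" "norm w < 1"
  shows "1 - b * w \<noteq> 0"
proof
  assume "1 - b * w = 0"
  then have "norm (b * w) = 1" by simp
  moreover have "norm (b * w) \<le> 1 * norm w"
    unfolding norm_mult using assms by (intro mult_right_mono) auto
  ultimately show False using assms by simp
qed

section \<open>Rogosinski's averaging argument\<close>

lemma sum_powers_root_of_unity:
  assumes m: "0 < m" "m < n"
  shows "(\<Sum>k<n. (cis (2 * pi / real n) ^ k) ^ m) = 0"
proof -
  define \<omega> where "\<omega> = cis (2 * pi / real n) ^ m"
  have "\<omega> = cis (2 * pi * real m / real n)"
    by (simp add: \<omega>_def Complex.DeMoivre mult_ac)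
  moreover have "cis (2 * pi * real m / real n) \<noteq> 1"
  proof
    assume "cis (2 * pi * real m / real n) = 1"
    then obtain j :: int where "2 * pi * real m / real n = 2 * pi * of_int j"
      by (auto simp: complex_eq_iff cos_one_2pi_int)
    then have "real m = of_int j * real n" using m by (simp add: field_simps)
    then have "int m = j * int n" by (metis of_int_eq_iff of_int_mult of_int_of_nat_eq)
    then have "n dvd m" by (metis dvd_triv_right int_dvd_int_iff)
    then show False using m by (auto dest: dvd_imp_le)
  qed
  moreover have "\<omega> ^ n = 1"
  proof -
    have "cis (2 * pi / real n) ^ n = 1" using m by (simp add: Complex.DeMoivre)
    then show ?thesis by (metis \<omega>_def mult.commute power_mult power_one)
  qed
  ultimately have "(\<Sum>k<n. \<omega> ^ k) = 0" by (simp add: geometric_sum)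
  then show ?thesis by (simp add: \<omega>_def mult.commute flip: power_mult)
qed

text \<open>
  The averaging multiplies the coefficient of \<open>z^m\<close> by the mean of the \<open>m\<close>-th powers of the
  \<open>n\<close>-th roots of unity. This factor is 1 for \<open>m = n\<close> and 0 for \<open>0 < m < n\<close>; the remaining
  low coefficient, for \<open>m = 0\<close>, is \<open>s 0\<close>.
\<close>
lemma rotation_mean_expansion:
  fixes s :: "complex \<Rightarrow> complex"
  assumes hol: "s holomorphic_on \<Delta>" and s0: "s 0 = 0" and n: "0 < n"
    and F: "s has_fps_expansion F"
  obtains S where
    "(\<lambda>z. \<Sum>k<n. (1 / real n) *\<^sub>R s (cis (2 * pi / real n) ^ k * z)) has_fps_expansion S"
    "\<And>m. m < n \<Longrightarrow> fps_nth S m = 0" "fps_nth S n = fps_nth F n"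
proof
  let ?\<omega> = "cis (2 * pi / real n)"
  define S where "S = Abs_fps (\<lambda>m. fps_nth F m * (\<Sum>k<n. (?\<omega> ^ k) ^ m) / of_nat n)"
  have "(\<lambda>m. fps_nth S m * z ^ m) sums (\<Sum>k<n. (1 / real n) *\<^sub>R s (?\<omega> ^ k * z))"
    if z: "z \<in> \<Delta>" for z
  proof -
    have "(\<lambda>m. fps_nth F m * (?\<omega> ^ k * z) ^ m) sums s (?\<omega> ^ k * z)" for k
    proof -
      have "?\<omega> ^ k * z \<in> \<Delta>" using z by (simp add: norm_mult norm_power)
      from holomorphic_power_series[OF hol this] show ?thesis
        by (simp add: fps_nth_fps_expansion[OF F])
    qed
    then have "(\<lambda>m. \<Sum>k<n. (1 / real n) *\<^sub>R (fps_nth F m * (?\<omega> ^ k * z) ^ m))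
        sums (\<Sum>k<n. (1 / real n) *\<^sub>R s (?\<omega> ^ k * z))"
      by (intro sums_sum sums_scaleR_right)
    also have "(\<lambda>m. \<Sum>k<n. (1 / real n) *\<^sub>R (fps_nth F m * (?\<omega> ^ k * z) ^ m))
        = (\<lambda>m. fps_nth S m * z ^ m)"
      by (simp add: S_def fun_eq_iff scaleR_conv_of_real power_mult_distrib sum_distrib_left
            sum_distrib_right sum_divide_distrib mult_ac)
    finally show ?thesis .
  qed
  then show "(\<lambda>z. \<Sum>k<n. (1 / real n) *\<^sub>R s (?\<omega> ^ k * z)) has_fps_expansion S"
    by (intro has_fps_expansionI eventually_mono[OF eventually_nhds_in_open[of \<Delta>]]) auto
  show "fps_nth S m = 0" if "m < n" for m
  proof (cases "m = 0")
    case True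
    then show ?thesis using fps_nth_fps_expansion[OF F, of 0] s0 by (simp add: S_def)
  next
    case False
    then show ?thesis using sum_powers_root_of_unity[of m n] that by (simp add: S_def)
  qed
  have "(?\<omega> ^ k) ^ n = 1" for k
  proof -
    have "?\<omega> ^ n = 1" using n by (simp add: Complex.DeMoivre)
    then show ?thesis by (metis mult.commute power_mult power_one)
  qed
  then show "fps_nth S n = fps_nth F n" using n by (simp add: S_def)
qed

text \<open>
  With \<open>S\<close> the rotation mean of \<open>s = w / (1 - b w)\<close>, the function \<open>g = S / (1 + b S)\<close> is what
  \<open>w\<close> becomes when \<open>s\<close> is replaced by \<open>S\<close>. Convexity gives \<open>\<bar>g\<bar> < 1\<close>, and since \<open>S\<close> has
  no terms below \<open>z^n\<close>, neither has \<open>g\<close>, and their coefficients of \<open>z^n\<close> agree.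
\<close>
lemma coeff_subordinate_mobius_le:
  fixes b :: complex
  assumes b: "norm b \<le> 1" and w: "w \<in> class_B"
    and F: "(\<lambda>z. w z / (1 - b * w z)) has_fps_expansion F"
  shows "norm (fps_nth F n) \<le> 1"
proof (cases "n = 0")
  case True
  then show ?thesis using fps_nth_fps_expansion[OF F, of 0] w by (simp add: class_B_def)
next
  case False
  define s where "s = (\<lambda>z. w z / (1 - b * w z))"
  define S where "S = (\<lambda>z. \<Sum>k<n. (1 / real n) *\<^sub>R s (cis (2 * pi / real n) ^ k * z))"
  let ?C = "{s. norm s < norm (1 + b * s)}"
  have n: "0 < n" using False by simp
  have w': "w holomorphic_on \<Delta>" "w 0 = 0" "\<And>z. z \<in> \<Delta> \<Longrightarrow> norm (w z) < 1"
    using w by (auto simp: class_B_def)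
  have nz: "1 - b * w z \<noteq> 0" if "z \<in> \<Delta>" for z
    using one_minus_mult_nonzero[OF b w'(3)[OF that]] .
  have hols: "s holomorphic_on \<Delta>"
    unfolding s_def using w'(1) nz by (intro holomorphic_intros) auto
  have rot: "cis (2 * pi / real n) ^ k * z \<in> \<Delta>" if "z \<in> \<Delta>" for k z
    using that by (simp add: norm_mult norm_power)
  have holS: "S holomorphic_on \<Delta>"
    unfolding S_def
    by (intro holomorphic_intros holomorphic_on_compose_gen[OF _ hols, unfolded o_def])
       (use rot in auto)
  have sC: "s z \<in> ?C" if "z \<in> \<Delta>" for z
  proof -
    have "1 + b * s z = 1 / (1 - b * w z)"
      using nz[OF that] by (simp add: s_def field_simps)
    then show ?thesis
      using nz[OF that] w'(3)[OF that] by (simp add: s_def norm_divide divide_strict_right_mono)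
  qed
  have SC: "S z \<in> ?C" if "z \<in> \<Delta>" for z
    unfolding S_def
    by (rule convex_sum[OF _ convex_mobius_image[OF b]])
       (use n sC[OF rot[OF that]] in auto)
  have nzS: "1 + b * S z \<noteq> 0" if "z \<in> \<Delta>" for z using SC[OF that] by auto
  define g where "g = (\<lambda>z. S z / (1 + b * S z))"
  have holg: "g holomorphic_on \<Delta>"
    unfolding g_def using holS nzS by (intro holomorphic_intros) auto
  have bdg: "norm (g z) \<le> 1" if "z \<in> \<Delta>" for z
    using SC[OF that] nzS[OF that] by (simp add: g_def norm_divide divide_simps)
  obtain T where T: "S has_fps_expansion T" "\<And>m. m < n \<Longrightarrow> fps_nth T m = 0"
    "fps_nth T n = fps_nth F n"
    using rotation_mean_expansion[OF hols _ n F[folded s_def]] w'(2)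
    unfolding S_def by (auto simp: s_def)
  obtain G where G: "g has_fps_expansion G"
    using analytic_at_imp_has_fps_expansion_0[of g] holg
    by (metis analytic_at centre_in_ball open_ball zero_less_one)
  \<comment> \<open>The definition of \<open>g\<close> in the product form \<open>S = g + b S g\<close>, whose last term vanishes at 0
      to order greater than \<open>n\<close>.\<close>
  have "S has_fps_expansion G + fps_const b * T * G"
  proof (subst has_fps_expansion_cong)
    show "(\<lambda>z. g z + b * S z * g z) has_fps_expansion G + fps_const b * T * G"
      by (intro fps_expansion_intros G T(1))
    show "\<forall>\<^sub>F z in nhds 0. S z = g z + b * S z * g z"
    proof (rule eventually_mono[OF eventually_nhds_in_open[of \<Delta>]])
      fix z :: complex
      assume "z \<in> \<Delta>"
      then have "g z * (1 + b * S z) = S z" using nzS by (simp add: g_def)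
      then show "S z = g z + b * S z * g z" by (simp add: algebra_simps)
    qed auto
  qed auto
  then have "T = G + fps_const b * T * G"
    using T(1) fps_expansion_unique_complex by blast
  then have "fps_nth T n = fps_nth G n + b * fps_nth (T * G) n"
    by (metis fps_add_nth fps_mult_left_const_nth mult.assoc)
  moreover have "fps_nth (T * G) n = 0"
  proof -
    \<comment> \<open>Every term with \<open>i < n\<close> has a vanishing factor from \<open>T\<close>; the last one has the factor
        \<open>g 0 = 0\<close>.\<close>
    have "fps_nth G 0 = 0"
      using fps_nth_fps_expansion[OF G, of 0] fps_nth_fps_expansion[OF T(1), of 0] T(2)[OF n]
      by (simp add: g_def)
    then show ?thesis
      unfolding fps_mult_nth by (intro sum.neutral) (metis T(2) atLeastAtMost_iff
        diff_self_eq_0 le_neq_implies_less mult_zero_left mult_zero_right)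
  qed
  ultimately have "fps_nth G n = fps_nth F n" using T(3) by simp
  then show ?thesis using bounded_on_disk_coeff_le[OF holg bdg G, of n] by simp
qed

section \<open>Functions subordinate to the Booth function\<close>

lemma booth_eq_mean:
  assumes \<alpha>: "\<alpha> = \<beta>\<^sup>2" and "\<bar>\<beta>\<bar> \<le> 1" and "norm w < 1"
  shows "booth \<alpha> w = (w / (1 - of_real \<beta> * w) + w / (1 - (- of_real \<beta>) * w)) / 2"
proof -
  define A B where "A = 1 - of_real \<beta> * w" and "B = 1 - (- of_real \<beta>) * w"
  have "A \<noteq> 0" "B \<noteq> 0"
    unfolding A_def B_def using assms by (intro one_minus_mult_nonzero; simp)+
  then have "(w / A + w / B) / 2 = (A + B) / 2 * (w / (A * B))"
    by (simp add: field_simps)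
  also have "A + B = 2" by (simp add: A_def B_def)
  also have "A * B = 1 - of_real \<alpha> * w\<^sup>2"
    by (simp add: A_def B_def \<alpha> power2_eq_square algebra_simps)
  also have "2 / 2 * (w / (1 - of_real \<alpha> * w\<^sup>2)) = booth \<alpha> w"
    by (simp add: booth_def)
  finally show ?thesis by (simp add: A_def B_def)
qed

lemma coeff_subordinate_booth_le:
  assumes \<alpha>: "0 \<le> \<alpha>" "\<alpha> \<le> 1" and p: "p \<prec> booth \<alpha>" and P: "p has_fps_expansion P"
  shows "norm (fps_nth P n) \<le> 1"
proof -
  obtain w where w: "w \<in> class_B" and pw: "\<And>z. z \<in> \<Delta> \<Longrightarrow> p z = booth \<alpha> (w z)"
    using p by (auto simp: subordinate_def)
  define \<beta> where "\<beta> = sqrt \<alpha>"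
  have \<beta>: "\<alpha> = \<beta>\<^sup>2" "\<bar>\<beta>\<bar> \<le> 1" using \<alpha> by (auto simp: \<beta>_def)
  have "\<exists>F. (\<lambda>z. w z / (1 - b * w z)) has_fps_expansion F" if "norm b \<le> 1" for b
  proof -
    have "(\<lambda>z. w z / (1 - b * w z)) holomorphic_on \<Delta>"
      using w one_minus_mult_nonzero[OF that] by (intro holomorphic_intros) (auto simp: class_B_def)
    then show ?thesis
      by (metis analytic_at analytic_at_imp_has_fps_expansion_0 centre_in_ball open_ball
          zero_less_one)
  qed
  from this[of "of_real \<beta>"] this[of "- of_real \<beta>"] \<beta>(2) obtain F1 F2 where
    F: "(\<lambda>z. w z / (1 - of_real \<beta> * w z)) has_fps_expansion F1"
       "(\<lambda>z. w z / (1 - (- of_real \<beta>) * w z)) has_fps_expansion F2"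
    by auto
  have "p has_fps_expansion fps_const (1/2) * (F1 + F2)"
  proof (subst has_fps_expansion_cong)
    show "(\<lambda>z. 1/2 * (w z / (1 - of_real \<beta> * w z) + w z / (1 - (- of_real \<beta>) * w z)))
        has_fps_expansion fps_const (1/2) * (F1 + F2)"
      by (intro has_fps_expansion_cmult_left has_fps_expansion_add F)
    show "\<forall>\<^sub>F z in nhds 0. p z
        = 1/2 * (w z / (1 - of_real \<beta> * w z) + w z / (1 - (- of_real \<beta>) * w z))"
    proof (rule eventually_mono[OF eventually_nhds_in_open[of \<Delta>]])
      fix z :: complex
      assume z: "z \<in> \<Delta>"
      then have "norm (w z) < 1" using w by (simp add: class_B_def)
      from booth_eq_mean[OF \<beta> this]
      show "p z = 1/2 * (w z / (1 - of_real \<beta> * w z) + w z / (1 - (- of_real \<beta>) * w z))"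
        using pw[OF z] by simp
    qed auto
  qed auto
  then have "P = fps_const (1/2) * (F1 + F2)"
    using P fps_expansion_unique_complex by blast
  then have "norm (fps_nth P n) = norm (fps_nth F1 n + fps_nth F2 n) / 2"
    by (simp add: norm_divide)
  also have "\<dots> \<le> (1 + 1) / 2"
    using \<beta>(2)
    by (intro divide_right_mono order_trans[OF norm_triangle_ineq] add_mono
          coeff_subordinate_mobius_le[OF _ w F(1)] coeff_subordinate_mobius_le[OF _ w F(2)]) auto
  finally show ?thesis by simp
qed

section \<open>Logarithmic coefficients\<close>

text \<open>
  Differentiating \<open>f(z) = z exp (L z)\<close>, which holds also at 0, avoids dividing by \<open>z\<close>.
\<close>
lemma log_deriv_quotient_log_branch:
  assumes f: "f \<in> class_A" and L: "is_log_branch f L" and z: "z \<in> \<Delta>"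
  shows "log_deriv_quotient f z - 1 = z * deriv L z"
proof (cases "z = 0")
  case True
  then show ?thesis by (simp add: log_deriv_quotient_def)
next
  case False
  have fL: "u * exp (L u) = f u" if "u \<in> \<Delta>" for u
    using L f that by (cases "u = 0") (simp_all add: is_log_branch_def class_A_def)
  have dL: "(L has_field_derivative deriv L z) (at z)"
    using L z by (auto simp: is_log_branch_def intro: holomorphic_derivI)
  have "((\<lambda>u. u * exp (L u)) has_field_derivative exp (L z) + z * (exp (L z) * deriv L z)) (at z)"
    by (auto intro!: derivative_eq_intros dL)
  then have "(f has_field_derivative exp (L z) + z * (exp (L z) * deriv L z)) (at z)"
    by (rule has_field_derivative_transform_within_open[OF _ open_ball z]) (rule fL)
  then have "deriv f z = exp (L z) * (1 + z * deriv L z)"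
    by (simp add: DERIV_imp_deriv algebra_simps)
  then show ?thesis
    using False by (simp add: log_deriv_quotient_def flip: fL[OF z])
qed

theorem theorem2p7:
  fixes \<alpha> :: real and f :: "complex \<Rightarrow> complex"
  assumes "0 \<le> \<alpha>" and "\<alpha> \<le> 1"
    and "f \<in> class_BS \<alpha>"
  shows "\<forall>n\<ge>1. norm (log_coeff f n) \<le> 1 / (2 * real n)"
proof (intro allI impI)
  fix n :: nat
  assume n: "1 \<le> n"
  let ?\<gamma> = "log_coeff f"
  have f: "f \<in> class_A" and sub: "(\<lambda>z. log_deriv_quotient f z - 1) \<prec> booth \<alpha>"
    using assms(3) by (auto simp: class_BS_def)
  have \<gamma>0: "?\<gamma> 0 = 0" and "is_log_coeffs f ?\<gamma>"
    using is_log_coeffs_log_coeff[OF assms(3)] by auto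
  then obtain L where L: "is_log_branch f L"
    and sums: "\<And>z. z \<in> \<Delta> \<Longrightarrow> (\<lambda>n. 2 * ?\<gamma> (Suc n) * z ^ Suc n) sums L z"
    by (auto simp: is_log_coeffs_def)
  have ev: "\<forall>\<^sub>F z in nhds (0::complex). z \<in> \<Delta>"
    by (rule eventually_nhds_in_open) auto
  let ?G = "Abs_fps (\<lambda>n. 2 * ?\<gamma> n)"
  have "(\<lambda>n. 2 * ?\<gamma> n * z ^ n) sums L z" if "z \<in> \<Delta>" for z
    using sums_Suc_imp[of "\<lambda>n. 2 * ?\<gamma> n * z ^ n", OF _ sums[OF that]] \<gamma>0 by simp
  then have "L has_fps_expansion ?G"
    by (intro has_fps_expansionI eventually_mono[OF ev]) simp
  then have "(\<lambda>z. z * deriv L z) has_fps_expansion fps_X * fps_deriv ?G"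
    by (intro has_fps_expansion_mult has_fps_expansion_fps_X has_fps_expansion_deriv)
  then have "(\<lambda>z. log_deriv_quotient f z - 1) has_fps_expansion fps_X * fps_deriv ?G"
    by (subst has_fps_expansion_cong[OF eventually_mono[OF ev] refl])
       (rule log_deriv_quotient_log_branch[OF f L])
  from coeff_subordinate_booth_le[OF assms(1,2) sub this, of n]
  have "2 * real n * norm (?\<gamma> n) \<le> 1"
    using n by (simp add: norm_mult mult_ac)
  then show "norm (?\<gamma> n) \<le> 1 / (2 * real n)"
    using n by (simp add: field_simps)
qed

end
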